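(* Fix $\lambda,\kappa\in\mathbf{k}$. Let $(R,P)$ be an extended Rota-Baxter algebra of weight $(\lambda,\kappa)$. Define $$x\prec_P y:=xP(y),\quad x\succ_P y:=P(x)y,\quad x\bullet_P y:=xy,\quad x,y\in R.$$ Then $(R,\prec_P,\succ_P,\bullet_P)$ is an extended tridendriform algebra of weight $(\lambda,\kappa)$.
   Context: $\mathbf{k}$ is a field of characteristic $0$; a $\mathbf{k}$-algebra is a nonunitary associative $\mathbf{k}$-algebra; all operations are bilinear. An extended Rota-Baxter algebra of weight $(\lambda,\kappa)$ is a pair $(R,P)$ of a $\mathbf{k}$-algebra $R$ and a $\mathbf{k}$-linear map $P:R\to R$ with $P(x)P(y)=P(xP(y))+P(P(x)y)+\lambda P(xy)+\kappa xy$ for all $x,y\in R$. An extended tridendriform algebra of weight $(\lambda,\kappa)$ is a vector space $A$ with three binary operations $\prec,\succ,\bullet$ such that, with $\star_\lambda:=\prec+\succ+\lambda\bullet$, for all $x,y,z\in A$: $(x\prec y)\prec z=x\prec(y\star_\lambda z)+\kappa\, x\bullet(y\bullet z)$; $(x\succ y)\prec z=x\succ(y\prec z)$; $(x\star_\lambda y)\succ z+\kappa\,(x\bullet y)\bullet z=x\succ(y\succ z)$; $(x\succ y)\bullet z=x\succ(y\bullet z)$; $(x\prec y)\bullet z=x\bullet(y\succ z)$; $(x\bullet y)\prec z=x\bullet(y\prec z)$; $(x\bullet y)\bullet z=x\bullet(y\bullet z)$. *)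

theory Defs
  imports Complex_Main
begin

definition bilinear_op ::
    "('k::field \<Rightarrow> 'a::ab_group_add \<Rightarrow> 'a) \<Rightarrow> ('a \<Rightarrow> 'a \<Rightarrow> 'a) \<Rightarrow> bool" where
  "bilinear_op scale m \<longleftrightarrow>
     (\<forall>x. Vector_Spaces.linear scale scale (m x)) \<and>
     (\<forall>y. Vector_Spaces.linear scale scale (\<lambda>x. m x y))"

text \<open>The class \<^class>\<open>ring\<close> is the class of associative rings that need not have a unit.\<close>

locale nonunitary_algebra = vector_space scale
  for scale :: "'k::field_char_0 \<Rightarrow> 'a::ring \<Rightarrow> 'a" (infixr \<open>*s\<close> 75) +
  assumes bilinear_mult: "bilinear_op scale (*)"

locale extended_Rota_Baxter_algebra = nonunitary_algebra scale
  for scale :: "'k::field_char_0 \<Rightarrow> 'a::ring \<Rightarrow> 'a" (infixr \<open>*s\<close> 75) +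
  fixes lam \<kappa> :: 'k
    and P :: "'a \<Rightarrow> 'a"
  assumes linear_P: "Vector_Spaces.linear scale scale P"
    and Rota_Baxter: "P x * P y = P (x * P y) + P (P x * y) + lam *s P (x * y) + \<kappa> *s (x * y)"

definition tridendriform_star ::
    "('k \<Rightarrow> 'a::ab_group_add \<Rightarrow> 'a) \<Rightarrow> 'k \<Rightarrow> ('a \<Rightarrow> 'a \<Rightarrow> 'a) \<Rightarrow> ('a \<Rightarrow> 'a \<Rightarrow> 'a) \<Rightarrow> ('a \<Rightarrow> 'a \<Rightarrow> 'a)
      \<Rightarrow> 'a \<Rightarrow> 'a \<Rightarrow> 'a" where
  "tridendriform_star scale lam prec succ bul x y =
     prec x y + succ x y + scale lam (bul x y)"

locale extended_tridendriform_algebra = vector_space scale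
  for scale :: "'k::field_char_0 \<Rightarrow> 'a::ab_group_add \<Rightarrow> 'a" (infixr \<open>*s\<close> 75) +
  fixes lam \<kappa> :: 'k
    and prec :: "'a \<Rightarrow> 'a \<Rightarrow> 'a" (infix \<open>\<prec>\<close> 72)
    and succ :: "'a \<Rightarrow> 'a \<Rightarrow> 'a" (infix \<open>\<succ>\<close> 72)
    and bul :: "'a \<Rightarrow> 'a \<Rightarrow> 'a" (infix \<open>\<bullet>\<close> 72)
  assumes bilinear_prec: "bilinear_op scale (\<prec>)"
    and bilinear_succ: "bilinear_op scale (\<succ>)"
    and bilinear_bul: "bilinear_op scale (\<bullet>)"
    and prec_prec:
      "(x \<prec> y) \<prec> z =
         (x \<prec> tridendriform_star scale lam (\<prec>) (\<succ>) (\<bullet>) y z) + \<kappa> *s (x \<bullet> (y \<bullet> z))"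
    and succ_prec: "(x \<succ> y) \<prec> z = x \<succ> (y \<prec> z)"
    and star_succ:
      "(tridendriform_star scale lam (\<prec>) (\<succ>) (\<bullet>) x y \<succ> z) + \<kappa> *s ((x \<bullet> y) \<bullet> z) =
         x \<succ> (y \<succ> z)"
    and succ_bul: "(x \<succ> y) \<bullet> z = x \<succ> (y \<bullet> z)"
    and prec_bul: "(x \<prec> y) \<bullet> z = x \<bullet> (y \<succ> z)"
    and bul_prec: "(x \<bullet> y) \<prec> z = x \<bullet> (y \<prec> z)"
    and bul_bul: "(x \<bullet> y) \<bullet> z = x \<bullet> (y \<bullet> z)"

end

theory Submission
  imports Defs
begin

text \<open>
  For the three operations induced by \<open>P\<close>, the Rota-Baxter identity says that
  \<open>P (x \<star> y) + \<kappa> *s (x * y) = P x * P y\<close>: the map \<open>P\<close> is multiplicative from \<open>\<star>\<close> to the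
  product up to a \<open>\<kappa>\<close>-term (lemma \<open>P_star\<close>). Multiplying this identity by an element on the
  left gives the axiom for \<open>(x \<prec> y) \<prec> z\<close>, and on the right the axiom for \<open>x \<succ> (y \<succ> z)\<close>;
  the \<open>\<kappa>\<close>-terms in those axioms are precisely the defect of multiplicativity. In the other
  five axioms \<open>P\<close> is never applied to a product, so they are instances of associativity.
\<close>

lemma bilinear_op_compose_left:
  assumes "bilinear_op scale m" "Vector_Spaces.linear scale scale f"
  shows "bilinear_op scale (\<lambda>x y. m (f x) y)"
  using assms Vector_Spaces.linear_compose[OF assms(2), of scale "\<lambda>x. m x y" for y]
  by (auto simp: bilinear_op_def o_def)

lemma bilinear_op_compose_right:
  assumes "bilinear_op scale m" "Vector_Spaces.linear scale scale f"
  shows "bilinear_op scale (\<lambda>x y. m x (f y))"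
  using assms Vector_Spaces.linear_compose[OF assms(2), of scale "m x" for x]
  by (auto simp: bilinear_op_def o_def)

context nonunitary_algebra
begin

lemma mult_scale_right: "x * (c *s y) = c *s (x * y)"
  using bilinear_mult by (simp add: bilinear_op_def Vector_Spaces.linear_iff)

lemma mult_scale_left: "(c *s x) * y = c *s (x * y)"
  using bilinear_mult by (simp add: bilinear_op_def Vector_Spaces.linear_iff)

end

context extended_Rota_Baxter_algebra
begin

abbreviation star :: "'a \<Rightarrow> 'a \<Rightarrow> 'a" (infix \<open>\<star>\<close> 72) where
  "x \<star> y \<equiv> tridendriform_star scale lam (\<lambda>x y. x * P y) (\<lambda>x y. P x * y) (*) x y"

text \<open>
  Linearity of \<open>P\<close> merges the three summands of the Rota-Baxter identity in which \<open>P\<close> is the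
  outermost map into one value of \<open>P\<close>.
\<close>
lemma P_star: "P (x \<star> y) + \<kappa> *s (x * y) = P x * P y"
  using linear_P by (simp add: tridendriform_star_def Rota_Baxter Vector_Spaces.linear_iff)

lemma extended_tridendriform:
  "extended_tridendriform_algebra scale lam \<kappa> (\<lambda>x y. x * P y) (\<lambda>x y. P x * y) (*)"
proof
  show "bilinear_op scale (\<lambda>x y. x * P y)"
    by (rule bilinear_op_compose_right[OF bilinear_mult linear_P])
  show "bilinear_op scale (\<lambda>x y. P x * y)"
    by (rule bilinear_op_compose_left[OF bilinear_mult linear_P])
  show "bilinear_op scale (*)"
    by (rule bilinear_mult)
  show "x * P y * P z = x * P (y \<star> z) + \<kappa> *s (x * (y * z))" for x y z
    by (simp only: mult.assoc distrib_left mult_scale_right flip: P_star)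
  show "P (x \<star> y) * z + \<kappa> *s (x * y * z) = P x * (P y * z)" for x y z
  proof -
    have "P (x \<star> y) * z + \<kappa> *s (x * y * z) = (P (x \<star> y) + \<kappa> *s (x * y)) * z"
      by (simp only: distrib_right mult_scale_left)
    then show ?thesis
      by (simp only: P_star mult.assoc)
  qed
qed (simp_all add: mult.assoc)

end

theorem theorem2p5:
  fixes scale :: "'k::field_char_0 \<Rightarrow> 'a::ring \<Rightarrow> 'a"
    and lam \<kappa> :: 'k
    and P :: "'a \<Rightarrow> 'a"
  assumes "extended_Rota_Baxter_algebra scale lam \<kappa> P"
  shows "extended_tridendriform_algebra scale lam \<kappa>
           (\<lambda>x y. x * P y) (\<lambda>x y. P x * y) (\<lambda>x y. x * y)"
  using assms by (rule extended_Rota_Baxter_algebra.extended_tridendriform)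

end
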